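(* For every finite graph $H$, $$\mathrm{Hom}(H)\ \leq_{\mathrm P}^{\mathrm{Tur}}\ \mathrm{FulRel}(H)\ \leq_{\mathrm P}^{\mathrm{Tur}}\ \mathrm{SurHom}(H),$$ where $\leq_{\mathrm P}^{\mathrm{Tur}}$ denotes polynomial-time Turing reducibility.
   Context: Graphs are finite and undirected, with loops allowed: $G=(V_G,E_G)$ with $E_G\subseteq V_G\times V_G$ symmetric. For a graph $G$, a finite set $B$ and a relation $R\subseteq V_G\times B$ with full image (every $b\in B$ satisfies $(v,b)\in R$ for some $v$), $G\ast R$ is the graph with vertex set $B$ and edge set $\{(u,v)\in B\times B : \text{there is } (x,y)\in E_G \text{ with } (x,u),(y,v)\in R\}$. A relation from $G$ to $H$ is a relation $R\subseteq V_G\times V_H$ with full image such that $G\ast R=H$; it has full domain if every $x\in V_G$ is related to some vertex of $H$. For a fixed graph $H$, consider the following decision problems, each taking as input a finite graph $G$: - $\mathrm{Hom}(H)$: is there a homomorphism from $G$ to $H$? - $\mathrm{FulRel}(H)$: is there a relation with full domain from $G$ to $H$? - $\mathrm{SurHom}(H)$: is there a surjective homomorphism from $G$ to $H$, i.e. a homomorphism $f$ that is surjective on vertices and for which the induced map $E_G\to E_H$, $(x,y)\mapsto(f(x),f(y))$, is surjective? *)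

theory Defs
  imports
    "Graph_Theory.Pair_Digraph"
    "HOL-Computational_Algebra.Polynomial"
begin

section \<open>Oracle Turing machines and polynomial-time Turing reducibility\<close>

text \<open>
  Deterministic multi-tape oracle Turing machines with two-way infinite tapes. States are natural
  numbers below a bound. The tape symbols are the blank, the letters of the finite input alphabet
  \<open>'a\<close> (shared by input and oracle queries), and finitely many auxiliary symbols. Tape 0 is the
  input tape and tape 1 the query tape.
\<close>

datatype 'a tape_symbol = Blank | Letter 'a | Aux nat

datatype direction = Left | Stay | Right

fun offset :: "direction \<Rightarrow> int" where
  "offset Left = -1"
| "offset Stay = 0"
| "offset Right = 1"

record 'a otm =
  num_tapes :: nat
  num_aux :: nat
  num_states :: nat
  start_state :: nat
  accept_state :: nat
  reject_state :: nat
  query_state :: nat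
  yes_state :: nat
  no_state :: nat
  delta :: "nat \<Rightarrow> 'a tape_symbol list \<Rightarrow> nat \<times> ('a tape_symbol \<times> direction) list"

definition tape_alphabet :: "'a otm \<Rightarrow> 'a tape_symbol set" where
  "tape_alphabet M = {Blank} \<union> range Letter \<union> Aux ` {..<num_aux M}"

text \<open>
  Only the values of \<open>delta\<close> on the finitely many pairs of a state and a tuple of scanned symbols
  matter; \<open>otm\<close> requires that those values stay within the machine.
\<close>

definition otm :: "'a otm \<Rightarrow> bool" where
  "otm M \<longleftrightarrow>
     2 \<le> num_tapes M \<and>
     {start_state M, accept_state M, reject_state M, query_state M, yes_state M, no_state M}
       \<subseteq> {..<num_states M} \<and>
     distinct [accept_state M, reject_state M, query_state M] \<and>
     (\<forall>q < num_states M. \<forall>ss. length ss = num_tapes M \<and> set ss \<subseteq> tape_alphabet M \<longrightarrow>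
        fst (delta M q ss) < num_states M \<and>
        length (snd (delta M q ss)) = num_tapes M \<and>
        fst ` set (snd (delta M q ss)) \<subseteq> tape_alphabet M)"

text \<open>A tape is its contents together with the head position.\<close>

type_synonym 'a tape = "(int \<Rightarrow> 'a tape_symbol) \<times> int"

type_synonym 'a config = "nat \<times> 'a tape list"

definition read_tape :: "'a tape \<Rightarrow> 'a tape_symbol" where
  "read_tape t = fst t (snd t)"

definition act :: "'a tape_symbol \<times> direction \<Rightarrow> 'a tape \<Rightarrow> 'a tape" where
  "act a t = ((fst t)(snd t := fst a), snd t + offset (snd a))"

text \<open>
  The word on a tape starts in cell 0 and extends up to the first cell that does not hold a
  letter, wherever the head is.
\<close>

definition tape_word :: "'a tape \<Rightarrow> 'a list \<Rightarrow> bool" where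
  "tape_word t w \<longleftrightarrow>
     (\<forall>i < length w. fst t (int i) = Letter (w ! i)) \<and> fst t (int (length w)) \<notin> range Letter"

text \<open>
  Accepting and rejecting configurations are fixed points. A query costs one step and leaves all
  tapes unchanged.
\<close>

definition step :: "'a list set \<Rightarrow> 'a otm \<Rightarrow> 'a config \<Rightarrow> 'a config" where
  "step B M c =
     (if fst c \<in> {accept_state M, reject_state M} then c
      else if fst c = query_state M then
        (if \<exists>w \<in> B. tape_word (snd c ! 1) w then yes_state M else no_state M, snd c)
      else let r = delta M (fst c) (map read_tape (snd c))
           in (fst r, map2 act (snd r) (snd c)))"

definition word_tape :: "'a list \<Rightarrow> 'a tape" where
  "word_tape w =
     ((\<lambda>i. if 0 \<le> i \<and> i < int (length w) then Letter (w ! nat i) else Blank), 0)"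

definition initial_config :: "'a otm \<Rightarrow> 'a list \<Rightarrow> 'a config" where
  "initial_config M w = (start_state M, word_tape w # replicate (num_tapes M - 1) (word_tape []))"

definition decides_in_time ::
    "'a otm \<Rightarrow> 'a list set \<Rightarrow> 'a list set \<Rightarrow> (nat \<Rightarrow> nat) \<Rightarrow> bool" where
  "decides_in_time M B A T \<longleftrightarrow>
     (\<forall>w. \<exists>t \<le> T (length w).
        fst ((step B M ^^ t) (initial_config M w))
          = (if w \<in> A then accept_state M else reject_state M))"

definition poly_turing_reducible :: "'a::finite list set \<Rightarrow> 'a list set \<Rightarrow> bool"
    (infix "\<le>\<^sub>P\<^sup>T\<^sup>u\<^sup>r" 50) where
  "A \<le>\<^sub>P\<^sup>T\<^sup>u\<^sup>r B \<longleftrightarrow>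
     (\<exists>M p. otm M \<and> decides_in_time M B A (poly (p :: nat poly)))"


section \<open>Homomorphisms and relations between graphs\<close>

text \<open>
  Finite undirected graphs with loops allowed are exactly the instances of the locale
  \<^locale>\<open>pair_pseudo_graph\<close>; the null graph is included.
\<close>

definition graph_hom ::
    "'a pair_pre_digraph \<Rightarrow> 'b pair_pre_digraph \<Rightarrow> ('a \<Rightarrow> 'b) \<Rightarrow> bool" where
  "graph_hom G H f \<longleftrightarrow>
     (\<forall>x \<in> pverts G. f x \<in> pverts H) \<and> (\<forall>(x, y) \<in> parcs G. (f x, f y) \<in> parcs H)"

definition surjective_hom ::
    "'a pair_pre_digraph \<Rightarrow> 'b pair_pre_digraph \<Rightarrow> ('a \<Rightarrow> 'b) \<Rightarrow> bool" where
  "surjective_hom G H f \<longleftrightarrow>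
     graph_hom G H f \<and> f ` pverts G = pverts H \<and> (\<lambda>(x, y). (f x, f y)) ` parcs G = parcs H"

definition full_image :: "'b set \<Rightarrow> ('a \<times> 'b) set \<Rightarrow> bool" where
  "full_image B R \<longleftrightarrow> (\<forall>b \<in> B. \<exists>v. (v, b) \<in> R)"

definition full_domain :: "'a set \<Rightarrow> ('a \<times> 'b) set \<Rightarrow> bool" where
  "full_domain A R \<longleftrightarrow> (\<forall>x \<in> A. \<exists>b. (x, b) \<in> R)"

definition graph_star ::
    "'a pair_pre_digraph \<Rightarrow> 'b set \<Rightarrow> ('a \<times> 'b) set \<Rightarrow> 'b pair_pre_digraph" where
  "graph_star G B R =
     \<lparr> pverts = B,
       parcs = {(u, v) \<in> B \<times> B. \<exists>(x, y) \<in> parcs G. (x, u) \<in> R \<and> (y, v) \<in> R} \<rparr>"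

definition graph_relation ::
    "'a pair_pre_digraph \<Rightarrow> 'b pair_pre_digraph \<Rightarrow> ('a \<times> 'b) set \<Rightarrow> bool" where
  "graph_relation G H R \<longleftrightarrow>
     R \<subseteq> pverts G \<times> pverts H \<and> full_image (pverts H) R \<and> graph_star G (pverts H) R = H"


section \<open>The decision problems\<close>

text \<open>
  Instances are the finite graphs with vertex set \<open>{0, \<dots>, n - 1}\<close>, given by their adjacency matrix,
  written row by row with every row terminated by a separator. A decision problem is the language
  of the encodings of its yes-instances.
\<close>

datatype graph_letter = Zero | One | Sep

instance graph_letter :: finite
proof
  have "(UNIV :: graph_letter set) = {Zero, One, Sep}"
    using graph_letter.exhaust by auto
  then show "finite (UNIV :: graph_letter set)"
    by (metis finite.emptyI finite.insertI)
qed

definition encode_graph :: "nat pair_pre_digraph \<Rightarrow> graph_letter list" where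
  "encode_graph G =
     (let n = card (pverts G) in
      concat (map (\<lambda>i. map (\<lambda>j. if (i, j) \<in> parcs G then One else Zero) [0..<n] @ [Sep]) [0..<n]))"

definition decision_problem :: "(nat pair_pre_digraph \<Rightarrow> bool) \<Rightarrow> graph_letter list set" where
  "decision_problem P =
     {encode_graph G | G. pair_pseudo_graph G \<and> (\<exists>n. pverts G = {..<n}) \<and> P G}"

definition Hom :: "'b pair_pre_digraph \<Rightarrow> graph_letter list set" where
  "Hom H = decision_problem (\<lambda>G. \<exists>f. graph_hom G H f)"

definition FulRel :: "'b pair_pre_digraph \<Rightarrow> graph_letter list set" where
  "FulRel H = decision_problem (\<lambda>G. \<exists>R. graph_relation G H R \<and> full_domain (pverts G) R)"

definition SurHom :: "'b pair_pre_digraph \<Rightarrow> graph_letter list set" where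
  "SurHom H = decision_problem (\<lambda>G. \<exists>f. surjective_hom G H f)"

end

theory Submission
  imports Defs
begin

text \<open>
  Both reductions ask a single query. There is a homomorphism from \<open>G\<close> to \<open>H\<close> iff there is a
  full-domain relation from the disjoint union \<open>G + H\<close> to \<open>H\<close>: extend the homomorphism by the
  identity on \<open>H\<close>; conversely, any selection from a full-domain relation is a homomorphism. There is a
  full-domain relation from \<open>G\<close> to \<open>H\<close> iff the blow-up of \<open>G\<close>, in which every vertex is replaced by
  \<open>k \<ge> max 1 |H|\<close> copies, has a surjective homomorphism to \<open>H\<close>: the copies of \<open>x\<close> are mapped onto the
  nonempty set of vertices related to \<open>x\<close>. Both maps on adjacency matrices are computed in linear time
  by deterministic two-way finite transducers. No input validation beyond rejecting an unterminated
  last row is needed, because the image of a matrix is square and symmetric only if the matrix is.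
\<close>

section \<open>Two-way transducers\<close>

text \<open>\<open>Reject\<close> and \<open>Query\<close> both end a run; \<open>Query\<close>
  submits the output written so far and adopts the oracle's answer as the verdict.\<close>

datatype ('q, 'a) outcome = Reject | Query | Move 'q direction "'a list"

text \<open>Positions are integers because the head also visits -1; \<open>None\<close> serves as
  end marker on both sides.\<close>

definition cell :: "'a list \<Rightarrow> int \<Rightarrow> 'a option" where
  "cell w p = (if 0 \<le> p \<and> p < int (length w) then Some (w ! nat p) else None)"

lemma cell_append [simp]: "cell (u @ a # x) (int (length u)) = Some a"
  by (simp add: cell_def)

lemma cell_end [simp]: "cell w (int (length w)) = None"
  by (simp add: cell_def)

lemma cell_negative [simp]: "p < 0 \<Longrightarrow> cell w p = None"
  by (simp add: cell_def)

lemma cell_last: "cell w (int (length w) - 1) = (if w = [] then None else Some (last w))"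
  by (cases w rule: rev_cases) (auto simp: cell_def nat_diff_distrib)

text \<open>A configuration consists of the state, the position of the input head and the output.\<close>

inductive runs :: "('q \<Rightarrow> 'a option \<Rightarrow> ('q, 'a) outcome) \<Rightarrow> 'a list \<Rightarrow> nat \<Rightarrow>
    'q \<times> int \<times> 'a list \<Rightarrow> 'q \<times> int \<times> 'a list \<Rightarrow> bool"
  for tr w where
  refl: "runs tr w 0 c c"
| step: "tr q (cell w p) = Move q' d u \<Longrightarrow> runs tr w n (q', p + offset d, v @ u) c
    \<Longrightarrow> runs tr w (Suc n) (q, p, v) c"

lemma runs_trans: "runs tr w m c c' \<Longrightarrow> runs tr w n c' c'' \<Longrightarrow> runs tr w (m + n) c c''"
  by (induction rule: runs.induct) (auto intro: runs.step)

lemma runs_single: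
  "tr q (cell w p) = Move q' d u \<Longrightarrow> runs tr w 1 (q, p, v) (q', p + offset d, v @ u)"
  using runs.step[OF _ runs.refl] by fastforce

text \<open>A sweep in a constant state rewrites a block letter by letter. For the induction the
  block sits between arbitrary \<open>u\<close> and \<open>x\<close>, and its first letter is
  shifted into \<open>u\<close>.\<close>

lemma runs_scan_right:
  assumes "\<And>a. a \<in> set r \<Longrightarrow> tr q (Some a) = Move q Right (g a)"
  shows "runs tr (u @ r @ x) (length r) (q, int (length u), v)
    (q, int (length (u @ r)), v @ concat (map g r))"
  using assms
proof (induction r arbitrary: u v)
  case Nil
  then show ?case by (simp add: runs.refl)
next
  case (Cons a r)
  have "runs tr ((u @ [a]) @ r @ x) (length r) (q, int (length (u @ [a])), v @ g a)
      (q, int (length ((u @ [a]) @ r)), (v @ g a) @ concat (map g r))"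
    by (rule Cons.IH) (simp add: Cons.prems)
  then show ?case
    using Cons.prems[of a] by (auto intro!: runs.step simp: add_ac)
qed

text \<open>The head meets the last letter of the block first, hence the reverse induction; the
  sweep ends just left of the block, at -1 if \<open>u\<close> is empty.\<close>

lemma runs_scan_left:
  assumes "\<And>a. a \<in> set r \<Longrightarrow> tr q (Some a) = Move q Left []"
  shows "runs tr (u @ r @ x) (length r) (q, int (length (u @ r)) - 1, v) (q, int (length u) - 1, v)"
  using assms
proof (induction r arbitrary: x rule: rev_induct)
  case Nil
  then show ?case by (simp add: runs.refl)
next
  case (snoc a r)
  have IH: "runs tr (u @ r @ a # x) (length r) (q, int (length (u @ r)) - 1, v)
      (q, int (length u) - 1, v)"
    by (rule snoc.IH) (simp add: snoc.prems)
  have "cell (u @ r @ a # x) (int (length (u @ r))) = Some a"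
    using cell_append[of "u @ r" a x] by simp
  then show ?case
    using IH snoc.prems[of a] by (auto intro!: runs.step)
qed


section \<open>Simulation by oracle machines\<close>

fun letter_of :: "'a tape_symbol \<Rightarrow> 'a option" where
  "letter_of (Letter a) = Some a"
| "letter_of _ = None"

lemma letter_of_word_tape [simp]: "letter_of (fst (word_tape w) p) = cell w p"
  by (simp add: word_tape_def cell_def)

text \<open>Writing right behind the output keeps the query tape in the form
  \<open>word_tape\<close>, an invariant of the simulation.\<close>

lemma word_tape_snoc:
  "(fst (word_tape v))(int (length v) := Letter b) = fst (word_tape (v @ [b]))"
  by (auto simp: word_tape_def fun_eq_iff nth_append nat_less_iff)

text \<open>The oracle sees exactly the output: a shorter \<open>w\<close> would be followed by a
  letter, a longer one would cover a blank.\<close>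

lemma tape_word_word_tape: "tape_word (fst (word_tape v), p) w \<longleftrightarrow> w = v"
proof
  assume *: "tape_word (fst (word_tape v), p) w"
  have "\<not> length w < length v"
    using * by (auto simp: tape_word_def word_tape_def)
  moreover have "\<not> length v < length w"
    using * by (auto simp: tape_word_def word_tape_def)
  ultimately have "length w = length v" by simp
  then show "w = v"
    using * by (intro nth_equalityI) (auto simp: tape_word_def word_tape_def)
qed (auto simp: tape_word_def word_tape_def)

text \<open>
  A state of the simulating machine is a state of the transducer together with the output still to
  be written, numbered from 3 on; the states 0, 1, 2 are the accepting, rejecting and query states.
  The answer states coincide with the halting states.
\<close>

definition transducer_delta :: "('q \<Rightarrow> 'a option \<Rightarrow> ('q, 'a) outcome) \<Rightarrow> ('q \<times> 'a list \<Rightarrow> nat) \<Rightarrow>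
    (nat \<Rightarrow> 'q \<times> 'a list) \<Rightarrow> nat \<Rightarrow> 'a tape_symbol list \<Rightarrow> nat \<times> ('a tape_symbol \<times> direction) list"
  where
  "transducer_delta tr code decode n ss =
     (if n < 3 then (n, [(ss ! 0, Stay), (ss ! 1, Stay)])
      else case decode (n - 3) of
        (q, b # u) \<Rightarrow> (3 + code (q, u), [(ss ! 0, Stay), (Letter b, Right)])
      | (q, []) \<Rightarrow>
          (case tr q (letter_of (ss ! 0)) of
             Reject \<Rightarrow> (1, [(ss ! 0, Stay), (ss ! 1, Stay)])
           | Query \<Rightarrow> (2, [(ss ! 0, Stay), (ss ! 1, Stay)])
           | Move q' d u \<Rightarrow> (3 + code (q', u), [(ss ! 0, d), (ss ! 1, Stay)])))"

section \<open>The simulating machine\<close>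

text \<open>The bound \<open>L\<close> makes the set of pending outputs finite and limits the
  slowdown of the simulation.\<close>

locale transducer =
  fixes tr :: "'q \<Rightarrow> 'a::finite option \<Rightarrow> ('q, 'a) outcome"
    and Q :: "'q set" and q0 :: 'q and L :: nat
  assumes finite_states: "finite Q"
    and start: "q0 \<in> Q"
    and closed: "q \<in> Q \<Longrightarrow> tr q s = Move q' d u \<Longrightarrow> q' \<in> Q \<and> length u \<le> L"
begin

definition states :: "('q \<times> 'a list) set" where
  "states = Q \<times> {u. length u \<le> L}"

lemma finite_product_states: "finite states"
  using finite_lists_length_le[of "UNIV :: 'a set" L] finite_states by (simp add: states_def)

definition decode :: "nat \<Rightarrow> 'q \<times> 'a list" where
  "decode = (SOME f. bij_betw f {0..<card states} states)"

definition code :: "'q \<times> 'a list \<Rightarrow> nat" where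
  "code = inv_into {0..<card states} decode"

lemma bij_decode: "bij_betw decode {0..<card states} states"
  unfolding decode_def using ex_bij_betw_nat_finite[OF finite_product_states] by (rule someI_ex)

lemma decode_code: "s \<in> states \<Longrightarrow> decode (code s) = s"
  unfolding code_def using bij_decode by (simp add: bij_betw_inv_into_right)

lemma code_less: "s \<in> states \<Longrightarrow> code s < card states"
  unfolding code_def using bij_betw_inv_into[OF bij_decode] by (auto simp: bij_betw_def)

lemma decode_in: "n < card states \<Longrightarrow> decode n \<in> states"
  using bij_decode by (auto simp: bij_betw_def)

definition machine :: "'a otm" where
  "machine = \<lparr> num_tapes = 2, num_aux = 0, num_states = 3 + card states,
     start_state = 3 + code (q0, []), accept_state = 0, reject_state = 1, query_state = 2,
     yes_state = 0, no_state = 1, delta = transducer_delta tr code decode \<rparr>"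

text \<open>Writing a pending letter and making a move both lead to a pair in \<open>states\<close>,
  so every number that \<open>delta\<close> returns is below the state bound.\<close>

lemma otm_machine: "otm machine"
proof -
  have sub: "(q, u) \<in> states" if "(q, b # u) \<in> states" for q b u
    using that by (simp add: states_def)
  have nxt: "(q', u) \<in> states" if "(q, []) \<in> states" "tr q s = Move q' d u" for q s q' d u
    using that closed by (auto simp: states_def)
  have "(q0, []) \<in> states"
    using start by (simp add: states_def)
  then have start_less: "code (q0, []) < card states"
    by (rule code_less)
  have d: "fst (transducer_delta tr code decode n ss) < 3 + card states \<and>
      length (snd (transducer_delta tr code decode n ss)) = 2 \<and>
      fst ` set (snd (transducer_delta tr code decode n ss)) \<subseteq> tape_alphabet machine"
    if n: "n < 3 + card states" and ss: "length ss = 2" "set ss \<subseteq> tape_alphabet machine" for n ss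
  proof -
    have mem: "ss ! 0 \<in> tape_alphabet machine" "ss ! 1 \<in> tape_alphabet machine"
      using ss by (metis nth_mem subsetD pos2 one_less_numeral_iff semiring_norm(76))+
    have lett: "Letter b \<in> tape_alphabet machine" for b
      by (simp add: tape_alphabet_def)
    show ?thesis
    \<comment> \<open>\<open>step\<close> treats the states 0, 1, 2 specially, so their entries in
      \<open>delta\<close> only have to stay within the machine.\<close>
    proof (cases "n < 3")
      case True
      then show ?thesis using mem by (simp add: transducer_delta_def)
    next
      case False
      obtain q v where qv: "decode (n - 3) = (q, v)" by fastforce
      have st: "(q, v) \<in> states"
        using decode_in[of "n - 3"] qv False n by auto
      show ?thesis
      proof (cases v)
        case (Cons b u)
        then show ?thesis
          using False qv mem lett st code_less[OF sub] by (simp add: transducer_delta_def)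
      next
        case Nil
        then show ?thesis
          using False qv mem st code_less[OF nxt]
          by (auto simp: transducer_delta_def split: outcome.splits)
      qed
    qed
  qed
  show ?thesis
    unfolding otm_def using start_less d by (simp add: machine_def)
qed

section \<open>Correctness and time bound of the simulation\<close>

text \<open>Here \<open>u\<close> is the output still pending, and the second head stands right
  behind the written part \<open>v\<close>.\<close>

definition embed :: "'a list \<Rightarrow> 'q \<times> int \<times> 'a list \<Rightarrow> 'a list \<Rightarrow> 'a config" where
  "embed w c u = (case c of (q, p, v) \<Rightarrow>
     (3 + code (q, u), [(fst (word_tape w), p), (fst (word_tape v), int (length v))]))"

lemma step_write:
  assumes "(q, b # u) \<in> states"
  shows "Defs.step B machine (embed w (q, p, v) (b # u)) = embed w (q, p, v @ [b]) u"
  using assms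
  by (simp add: Defs.step_def machine_def embed_def transducer_delta_def decode_code read_tape_def
      act_def word_tape_snoc)

lemma steps_write:
  assumes "(q, u) \<in> states"
  shows "(Defs.step B machine ^^ length u) (embed w (q, p, v) u) = embed w (q, p, v @ u) []"
  using assms
proof (induction u arbitrary: v)
  case (Cons b u)
  then have "(q, u) \<in> states" by (simp add: states_def)
  then show ?case
    using Cons by (simp add: funpow_Suc_right step_write del: funpow.simps)
qed simp

text \<open>One step moves the input head and stores \<open>u\<close> in the state; each letter of
  \<open>u\<close> then takes one more step.\<close>

lemma steps_move:
  assumes "q \<in> Q" "tr q (cell w p) = Move q' d u"
  shows "(Defs.step B machine ^^ Suc (length u)) (embed w (q, p, v) [])
    = embed w (q', p + offset d, v @ u) []"
proof -
  have st: "(q, []) \<in> states" "(q', u) \<in> states"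
    using assms closed by (auto simp: states_def)
  have "Defs.step B machine (embed w (q, p, v) []) = embed w (q', p + offset d, v) u"
    using st assms(2)
    by (simp add: Defs.step_def machine_def embed_def transducer_delta_def decode_code
        read_tape_def act_def)
  then show ?thesis
    using steps_write[OF st(2)] by (simp add: funpow_Suc_right del: funpow.simps)
qed

lemma steps_runs:
  assumes "runs tr w n c c'" "fst c \<in> Q"
  shows "fst c' \<in> Q \<and>
    (\<exists>t \<le> Suc L * n. (Defs.step B machine ^^ t) (embed w c []) = embed w c' [])"
  using assms
proof (induction rule: runs.induct)
  case (refl c)
  then show ?case by auto
next
  case (step q p q' d u n v c)
  have q': "q' \<in> Q" and len: "length u \<le> L"
    using step closed by auto
  obtain t where t: "t \<le> Suc L * n" "fst c \<in> Q"
    "(Defs.step B machine ^^ t) (embed w (q', p + offset d, v @ u) []) = embed w c []"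
    using step.IH q' by auto
  \<comment> \<open>\<open>funpow_add\<close> performs the right summand first: the steps of the
    first move, then the \<open>t\<close> steps of the remaining run.\<close>
  have "(Defs.step B machine ^^ (t + Suc (length u))) (embed w (q, p, v) []) = embed w c []"
    using step.prems step.hyps t steps_move[of q w p q' d u B v]
    by (simp only: funpow_add comp_apply fst_conv)
  moreover have "t + Suc (length u) \<le> Suc L * Suc n"
    using t len by simp
  ultimately show ?case
    using t by blast
qed

text \<open>It remains to exhibit, for every input word, even one that encodes no graph, a
  transducer run of linear length ending in the right outcome.\<close>

theorem reducible:
  assumes run: "\<And>w. \<exists>n \<le> C * Suc (length w). \<exists>q p v. runs tr w n (q0, 0, []) (q, p, v) \<and>
    (tr q (cell w p) = Reject \<and> w \<notin> A \<or> tr q (cell w p) = Query \<and> (w \<in> A \<longleftrightarrow> v \<in> B))"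
  shows "A \<le>\<^sub>P\<^sup>T\<^sup>u\<^sup>r B"
proof -
  \<comment> \<open>The value at \<open>x\<close> is \<open>Suc L * C * (x + 1) + 2\<close>: the
    simulated run and two final steps.\<close>
  let ?p = "[:Suc L * C + 2, Suc L * C:]"
  have "\<exists>t \<le> poly ?p (length w). fst ((Defs.step B machine ^^ t) (initial_config machine w))
      = (if w \<in> A then accept_state machine else reject_state machine)" for w
  proof -
    obtain n q p v where n: "n \<le> C * Suc (length w)"
      and rn: "runs tr w n (q0, 0, []) (q, p, v)"
      and fin: "tr q (cell w p) = Reject \<and> w \<notin> A \<or>
        tr q (cell w p) = Query \<and> (w \<in> A \<longleftrightarrow> v \<in> B)"
      using run by blast
    obtain t where t: "t \<le> Suc L * n" and q: "q \<in> Q"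
      and eq: "(Defs.step B machine ^^ t) (embed w (q0, 0, []) []) = embed w (q, p, v) []"
      using steps_runs[OF rn] start by auto
    have init: "initial_config machine w = embed w (q0, 0, []) []"
      by (simp add: initial_config_def machine_def embed_def word_tape_def)
    have st: "(q, []) \<in> states"
      using q by (simp add: states_def)
    \<comment> \<open>\<open>Query\<close> takes one step to enter state 2 and one for the oracle
      call, whose answer states are the halting states; \<open>Reject\<close> halts after one step
      and stays there.\<close>
    have "fst ((Defs.step B machine ^^ 2) (embed w (q, p, v) []))
        = (if w \<in> A then accept_state machine else reject_state machine)"
      using fin st
      by (auto simp: numeral_2_eq_2 Defs.step_def machine_def embed_def transducer_delta_def
          decode_code read_tape_def act_def tape_word_word_tape)
    then have "fst ((Defs.step B machine ^^ (2 + t)) (initial_config machine w))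
        = (if w \<in> A then accept_state machine else reject_state machine)"
      by (simp only: funpow_add comp_apply init eq)
    moreover have "2 + t \<le> poly ?p (length w)"
    proof -
      have "t \<le> Suc L * (C * Suc (length w))"
        using t n by (meson le_trans mult_le_mono2)
      then show ?thesis by (simp add: algebra_simps)
    qed
    ultimately show ?thesis by blast
  qed
  then show ?thesis
    unfolding poly_turing_reducible_def decides_in_time_def using otm_machine by blast
qed

end


section \<open>Matrices and their encodings\<close>

text \<open>Rows may have any lengths, so that the output on invalid inputs can be described as
  well.\<close>

definition encode_rows :: "graph_letter list list \<Rightarrow> graph_letter list" where
  "encode_rows rs = concat (map (\<lambda>r. r @ [Sep]) rs)"

lemma encode_rows_simps [simp]:
  "encode_rows [] = []"
  "encode_rows (r # rs) = r @ Sep # encode_rows rs"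
  "encode_rows (rs @ rs') = encode_rows rs @ encode_rows rs'"
  by (simp_all add: encode_rows_def)

definition separator_free :: "graph_letter list list \<Rightarrow> bool" where
  "separator_free rs \<longleftrightarrow> (\<forall>r \<in> set rs. Sep \<notin> set r)"

lemma separator_free_simps [simp]:
  "separator_free []"
  "separator_free (r # rs) \<longleftrightarrow> Sep \<notin> set r \<and> separator_free rs"
  "separator_free (rs @ rs') \<longleftrightarrow> separator_free rs \<and> separator_free rs'"
  by (auto simp: separator_free_def)

text \<open>Both sides are cut at their first occurrence of \<open>a\<close>.\<close>

lemma append_separator_inject:
  "a \<notin> set r \<Longrightarrow> a \<notin> set r' \<Longrightarrow> r @ a # x = r' @ a # x' \<longleftrightarrow> r = r' \<and> x = x'"
proof (induction r arbitrary: r')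
  case Nil
  then show ?case by (cases r') auto
next
  case (Cons b r)
  then show ?case by (cases r') auto
qed

lemma encode_rows_inject:
  "separator_free rs \<Longrightarrow> separator_free rs' \<Longrightarrow> encode_rows rs = encode_rows rs' \<longleftrightarrow> rs = rs'"
proof (induction rs arbitrary: rs')
  case Nil
  then show ?case by (cases rs') auto
next
  case (Cons r rs)
  then show ?case by (cases rs') (auto simp: append_separator_inject)
qed

lemma last_encode_rows: "rs \<noteq> [] \<Longrightarrow> encode_rows rs \<noteq> [] \<and> last (encode_rows rs) = Sep"
  by (cases rs rule: rev_cases) auto

text \<open>Lets the transducers be analysed on arbitrary words. A further separator closes the
  unterminated tail \<open>t\<close>; any other letter extends it.\<close>

lemma word_split: "\<exists>rs t. separator_free rs \<and> Sep \<notin> set t \<and> w = encode_rows rs @ t"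
proof (induction w rule: rev_induct)
  case Nil
  show ?case by (intro exI[of _ "[]"]) simp
next
  case (snoc a w)
  then obtain rs t where *: "separator_free rs" "Sep \<notin> set t" "w = encode_rows rs @ t" by blast
  show ?case
  proof (cases "a = Sep")
    case True
    then show ?thesis using * by (intro exI[of _ "rs @ [t]"] exI[of _ "[]"]) simp
  next
    case False
    then show ?thesis using * by (intro exI[of _ rs] exI[of _ "t @ [a]"]) simp
  qed
qed

section \<open>Adjacency matrices and the graphs they describe\<close>

text \<open>Entries equal to \<open>Sep\<close> are excluded separately, by
  \<open>separator_free\<close>.\<close>

definition adjacency :: "graph_letter list list \<Rightarrow> bool" where
  "adjacency rs \<longleftrightarrow> (\<forall>r \<in> set rs. length r = length rs) \<and>
     (\<forall>i < length rs. \<forall>j < length rs. rs ! i ! j = rs ! j ! i)"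

definition matrix_graph :: "graph_letter list list \<Rightarrow> nat pair_pre_digraph" where
  "matrix_graph rs = \<lparr> pverts = {..<length rs},
     parcs = {(i, j). i < length rs \<and> j < length rs \<and> rs ! i ! j = One} \<rparr>"

definition rows :: "nat pair_pre_digraph \<Rightarrow> graph_letter list list" where
  "rows G = map (\<lambda>i. map (\<lambda>j. if (i, j) \<in> parcs G then One else Zero)
     [0..<card (pverts G)]) [0..<card (pverts G)]"

lemma encode_graph_rows: "encode_graph G = encode_rows (rows G)"
  by (simp add: encode_graph_def encode_rows_def rows_def Let_def comp_def)

lemma separator_free_rows: "separator_free (rows G)"
  by (auto simp: separator_free_def rows_def)

lemma adjacency_rows:
  assumes "pair_pseudo_graph G"
  shows "adjacency (rows G)"
proof -
  interpret pair_pseudo_graph G by fact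
  show ?thesis
    by (auto simp: adjacency_def rows_def dest: arcs_symmetric)
qed

lemma matrix_graph_rows:
  assumes "pair_pseudo_graph G" "pverts G = {..<n}"
  shows "matrix_graph (rows G) = G"
proof -
  interpret pair_pseudo_graph G by fact
  have "rows G ! i ! j = (if (i, j) \<in> parcs G then One else Zero)" if "i < n" "j < n" for i j
    using that assms(2) by (simp add: rows_def)
  moreover have "i < n \<and> j < n" if "(i, j) \<in> parcs G" for i j
    using arc_fst_in_verts[OF that] arc_snd_in_verts[OF that] assms(2) by simp
  moreover have len: "length (rows G) = n"
    using assms(2) by (simp add: rows_def)
  ultimately have "parcs (matrix_graph (rows G)) = parcs G"
    by (auto simp: matrix_graph_def split: if_splits)
  moreover have "pverts (matrix_graph (rows G)) = pverts G"
    using assms(2) len by (simp add: matrix_graph_def)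
  ultimately show ?thesis
    by simp
qed

lemma pair_pseudo_graph_matrix_graph:
  assumes "adjacency rs"
  shows "pair_pseudo_graph (matrix_graph rs)"
proof
  have "parcs (matrix_graph rs) \<subseteq> {..<length rs} \<times> {..<length rs}"
    by (auto simp: matrix_graph_def)
  then show "finite (parcs (matrix_graph rs))"
    using finite_subset by blast
  show "symmetric (with_proj (matrix_graph rs))"
    using assms
    by (auto simp: symmetric_def sym_def matrix_graph_def adjacency_def arcs_ends_conv)
qed (auto simp: matrix_graph_def)

lemma rows_matrix_graph:
  assumes "adjacency rs" "separator_free rs"
  shows "rows (matrix_graph rs) = rs"
proof (rule nth_equalityI)
  show "length (rows (matrix_graph rs)) = length rs"
    by (simp add: rows_def matrix_graph_def)
  fix i assume "i < length (rows (matrix_graph rs))"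
  then have i: "i < length rs"
    by (simp add: rows_def matrix_graph_def)
  have len: "length (rs ! i) = length rs"
    using assms(1) i by (simp add: adjacency_def)
  show "rows (matrix_graph rs) ! i = rs ! i"
  proof (rule nth_equalityI)
    show "length (rows (matrix_graph rs) ! i) = length (rs ! i)"
      using i len by (simp add: rows_def matrix_graph_def)
    fix j assume "j < length (rows (matrix_graph rs) ! i)"
    then have j: "j < length rs"
      using i by (simp add: rows_def matrix_graph_def)
    have "rs ! i ! j \<noteq> Sep"
      using assms(2) i j len unfolding separator_free_def by (metis nth_mem)
    then show "rows (matrix_graph rs) ! i ! j = rs ! i ! j"
      using i j by (cases "rs ! i ! j") (simp_all add: rows_def matrix_graph_def)
  qed
qed

section \<open>Membership of words in a decision problem\<close>

lemma decision_problemE: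
  assumes "w \<in> decision_problem P"
  obtains rs where "separator_free rs" "w = encode_rows rs"
  using assms separator_free_rows encode_graph_rows by (auto simp: decision_problem_def)

text \<open>By unique parsing \<open>rs\<close> must be \<open>rows G\<close>, and
  \<open>rows\<close> and \<open>matrix_graph\<close> are mutually inverse on valid matrices.
  Language membership thus becomes a property of the matrix.\<close>

lemma encode_rows_in_decision_problem:
  assumes "separator_free rs"
  shows "encode_rows rs \<in> decision_problem P \<longleftrightarrow> adjacency rs \<and> P (matrix_graph rs)"
proof
  assume "encode_rows rs \<in> decision_problem P"
  then obtain G n where G: "encode_rows rs = encode_graph G" "pair_pseudo_graph G"
      "pverts G = {..<n}" "P G"
    by (auto simp: decision_problem_def)
  then have "rs = rows G"
    using assms by (simp add: encode_graph_rows separator_free_rows encode_rows_inject)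
  then show "adjacency rs \<and> P (matrix_graph rs)"
    using G adjacency_rows matrix_graph_rows by simp
next
  assume *: "adjacency rs \<and> P (matrix_graph rs)"
  then have "encode_rows rs = encode_graph (matrix_graph rs)"
    using assms by (simp add: encode_graph_rows rows_matrix_graph)
  moreover have "pverts (matrix_graph rs) = {..<length rs}"
    by (simp add: matrix_graph_def)
  ultimately show "encode_rows rs \<in> decision_problem P"
    using * pair_pseudo_graph_matrix_graph by (auto simp: decision_problem_def)
qed

text \<open>Justifies the single input test of both transducers; \<open>None\<close> covers the
  empty word, where the position is -1.\<close>

lemma last_cell_separator_iff:
  assumes "Sep \<notin> set t" "w = encode_rows rs @ t"
  shows "cell w (int (length w) - 1) \<in> {None, Some Sep} \<longleftrightarrow> t = []"
proof -
  have "last (encode_rows rs) = Sep" if "encode_rows rs \<noteq> []"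
    using that last_encode_rows[of rs] by (cases "rs = []") auto
  moreover have "last t \<noteq> Sep" if "t \<noteq> []"
    using assms(1) that by (metis last_in_set)
  ultimately show ?thesis
    using assms(2) unfolding cell_last by (cases "t = []") auto
qed

text \<open>A nonempty encoding ends in \<open>Sep\<close>, whereas this word ends in a letter of
  \<open>t\<close>.\<close>

lemma trailing_letters_not_in_decision_problem:
  assumes "Sep \<notin> set t" "t \<noteq> []"
  shows "encode_rows rs @ t \<notin> decision_problem P"
proof
  assume "encode_rows rs @ t \<in> decision_problem P"
  then obtain rs' where "encode_rows rs @ t = encode_rows rs'"
    by (rule decision_problemE)
  moreover from this have "last (encode_rows rs') = Sep"
    using assms last_encode_rows[of rs'] by (cases "rs' = []") auto
  ultimately show False
    using assms by (metis last_appendR last_in_set)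
qed


section \<open>Homomorphisms as full-domain relations\<close>

text \<open>
  The adjacency matrix of the disjoint union of a graph and the graph on \<open>{..<h}\<close> with adjacency
  \<open>b\<close>.
\<close>

definition add_graph :: "nat \<Rightarrow> (nat \<Rightarrow> nat \<Rightarrow> bool) \<Rightarrow> graph_letter list list \<Rightarrow> graph_letter list list"
  where
  "add_graph h b rs = map (\<lambda>r. r @ replicate h Zero) rs @
     map (\<lambda>j. replicate (length rs) Zero @ map (\<lambda>i. if b j i then One else Zero) [0..<h]) [0..<h]"

lemma length_add_graph [simp]: "length (add_graph h b rs) = length rs + h"
  by (simp add: add_graph_def)

lemma separator_free_add_graph: "separator_free rs \<Longrightarrow> separator_free (add_graph h b rs)"
  by (auto simp: add_graph_def separator_free_def)

text \<open>The matrix is block diagonal; \<open>rs\<close> has to be square for the padding to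
  start in column \<open>length rs\<close>.\<close>

lemma add_graph_nth:
  assumes "\<And>r. r \<in> set rs \<Longrightarrow> length r = length rs" "i < length rs + h" "j < length rs + h"
  shows "add_graph h b rs ! i ! j =
    (if i < length rs then if j < length rs then rs ! i ! j else Zero
     else if j < length rs then Zero
     else if b (i - length rs) (j - length rs) then One else Zero)"
proof (cases "i < length rs")
  case True
  then have "add_graph h b rs ! i = rs ! i @ replicate h Zero"
    by (simp add: add_graph_def nth_append)
  moreover have "length (rs ! i) = length rs"
    using assms(1) True by simp
  ultimately show ?thesis
    using True assms(3) by (simp add: nth_append)
next
  case False
  then have "add_graph h b rs ! i = replicate (length rs) Zero @
      map (\<lambda>j. if b (i - length rs) j then One else Zero) [0..<h]"
    using assms(2) by (simp add: add_graph_def nth_append)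
  moreover have "j - length rs < h" if "\<not> j < length rs"
    using assms(3) that by simp
  ultimately show ?thesis
    using False by (simp add: nth_append)
qed

text \<open>The direction from left to right spares the transducer a validity test: invalid matrices
  have invalid images.\<close>

lemma adjacency_add_graph:
  assumes "\<And>i j. i < h \<Longrightarrow> j < h \<Longrightarrow> b i j \<longleftrightarrow> b j i"
  shows "adjacency (add_graph h b rs) \<longleftrightarrow> adjacency rs"
proof (cases "\<forall>r \<in> set rs. length r = length rs")
  case True
  then have nth: "add_graph h b rs ! i ! j =
    (if i < length rs then if j < length rs then rs ! i ! j else Zero
     else if j < length rs then Zero
     else if b (i - length rs) (j - length rs) then One else Zero)"
    if "i < length rs + h" "j < length rs + h" for i j
    using add_graph_nth[of rs i h j b] that by blast
  have "\<forall>r \<in> set (add_graph h b rs). length r = length (add_graph h b rs)"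
    using True by (auto simp: add_graph_def)
  moreover have "(\<forall>i < length rs + h. \<forall>j < length rs + h.
        add_graph h b rs ! i ! j = add_graph h b rs ! j ! i) \<longleftrightarrow>
      (\<forall>i < length rs. \<forall>j < length rs. rs ! i ! j = rs ! j ! i)"
  proof (intro iffI allI impI)
    fix i j
    assume "\<forall>i < length rs + h. \<forall>j < length rs + h.
        add_graph h b rs ! i ! j = add_graph h b rs ! j ! i"
      and "i < length rs" "j < length rs"
    then show "rs ! i ! j = rs ! j ! i"
      using nth by (metis trans_less_add1)
  next
    fix i j
    assume "\<forall>i < length rs. \<forall>j < length rs. rs ! i ! j = rs ! j ! i"
      and "i < length rs + h" "j < length rs + h"
    then show "add_graph h b rs ! i ! j = add_graph h b rs ! j ! i"
      using assms[of "i - length rs" "j - length rs"] by (auto simp: nth)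
  qed
  ultimately show ?thesis
    using True by (simp add: adjacency_def)
next
  case False
  then obtain r where "r \<in> set rs" "length r \<noteq> length rs" by blast
  \<comment> \<open>Row length and number of rows both grow by \<open>h\<close>, so the mismatch
    survives.\<close>
  moreover from this have "r @ replicate h Zero \<in> set (add_graph h b rs)"
    by (simp add: add_graph_def)
  ultimately have "\<not> adjacency (add_graph h b rs)"
    unfolding adjacency_def by fastforce
  moreover have "\<not> adjacency rs"
    using False by (auto simp: adjacency_def)
  ultimately show ?thesis by blast
qed

section \<open>Full-domain relations from a disjoint union\<close>

lemma graph_relation_arcD:
  assumes "graph_relation G H R" "(x, y) \<in> parcs G" "(x, u) \<in> R" "(y, v) \<in> R"
  shows "(u, v) \<in> parcs H"
proof -
  have "parcs H = parcs (graph_star G (pverts H) R)" and "u \<in> pverts H" "v \<in> pverts H"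
    using assms by (auto simp: graph_relation_def)
  then show ?thesis
    using assms(2-4) by (auto simp: graph_star_def)
qed

text \<open>\<open>graph_star\<close> keeps only pairs inside the vertex set of \<open>H\<close>;
  well-formedness puts the arcs of \<open>H\<close> there too, so equality splits into two
  implications about arcs.\<close>

lemma graph_relationI:
  assumes "R \<subseteq> pverts G \<times> pverts H" "pair_wf_digraph H"
    and "\<And>b. b \<in> pverts H \<Longrightarrow> \<exists>v. (v, b) \<in> R"
    and "\<And>x y u v. (x, y) \<in> parcs G \<Longrightarrow> (x, u) \<in> R \<Longrightarrow> (y, v) \<in> R \<Longrightarrow> (u, v) \<in> parcs H"
    and "\<And>u v. (u, v) \<in> parcs H \<Longrightarrow> \<exists>(x, y) \<in> parcs G. (x, u) \<in> R \<and> (y, v) \<in> R"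
  shows "graph_relation G H R"
proof -
  interpret pair_wf_digraph H by fact
  have "parcs (graph_star G (pverts H) R) = parcs H"
    using assms(4,5) arc_fst_in_verts arc_snd_in_verts by (fastforce simp: graph_star_def)
  moreover have "pverts (graph_star G (pverts H) R) = pverts H"
    by (simp add: graph_star_def)
  ultimately show ?thesis
    using assms(1,3) by (auto simp: graph_relation_def full_image_def)
qed

text \<open>\<open>e\<close> numbers the vertices of \<open>H\<close>; in the union, vertex
  \<open>length rs + i\<close> is the copy of \<open>e i\<close>.\<close>

lemma full_relation_add_graph_iff:
  assumes H: "pair_pseudo_graph H" and e: "bij_betw e {..<h} (pverts H)"
    and len: "\<And>r. r \<in> set rs \<Longrightarrow> length r = length rs"
  shows "(\<exists>R. graph_relation (matrix_graph (add_graph h (\<lambda>i j. (e i, e j) \<in> parcs H) rs)) H R \<and>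
      full_domain (pverts (matrix_graph (add_graph h (\<lambda>i j. (e i, e j) \<in> parcs H) rs))) R) \<longleftrightarrow>
    (\<exists>f. graph_hom (matrix_graph rs) H f)"
proof -
  interpret H: pair_pseudo_graph H by fact
  let ?n = "length rs"
  define b where "b = (\<lambda>i j. (e i, e j) \<in> parcs H)"
  let ?G = "matrix_graph rs" and ?G' = "matrix_graph (add_graph h b rs)"
  have verts: "pverts ?G' = {..<?n + h}" "pverts ?G = {..<?n}"
    by (simp_all add: matrix_graph_def)
  \<comment> \<open>The zero blocks leave no arc between the two parts.\<close>
  have arcs: "parcs ?G' = parcs ?G \<union>
      {(?n + i, ?n + j) | i j. i < h \<and> j < h \<and> (e i, e j) \<in> parcs H}" (is "_ = _ \<union> ?E")
  proof (intro set_eqI, clarify)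
    fix i j
    show "(i, j) \<in> parcs ?G' \<longleftrightarrow> (i, j) \<in> parcs ?G \<union> ?E"
    proof (cases "i < ?n + h \<and> j < ?n + h")
      case True
      then show ?thesis
        using add_graph_nth[OF len, where i = i and j = j and h = h and b = b]
        by (auto simp: matrix_graph_def b_def intro!: exI[of _ "_ - ?n"])
    next
      case False
      then show ?thesis by (auto simp: matrix_graph_def)
    qed
  qed
  have "(\<exists>R. graph_relation ?G' H R \<and> full_domain (pverts ?G') R) \<longleftrightarrow> (\<exists>f. graph_hom ?G H f)"
  proof
    assume "\<exists>R. graph_relation ?G' H R \<and> full_domain (pverts ?G') R"
    then obtain R where R: "graph_relation ?G' H R" "full_domain (pverts ?G') R" by blast
    \<comment> \<open>Any selection works, since \<open>graph_relation_arcD\<close> holds for every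
      choice of vertices related to the ends of an arc.\<close>
    define f where "f x = (SOME u. (x, u) \<in> R)" for x
    have f: "(x, f x) \<in> R" if "x < ?n" for x
      using R(2) that verts unfolding full_domain_def f_def
      by (metis lessThan_iff someI_ex trans_less_add1)
    have "f x \<in> pverts H" if "x < ?n" for x
      using f[OF that] R(1) by (auto simp: graph_relation_def)
    moreover have "(f x, f y) \<in> parcs H" if "(x, y) \<in> parcs ?G" for x y
    proof (rule graph_relation_arcD[OF R(1)])
      show "(x, y) \<in> parcs ?G'" using that arcs by blast
      show "(x, f x) \<in> R" "(y, f y) \<in> R" using that f by (auto simp: matrix_graph_def)
    qed
    ultimately have "graph_hom ?G H f"
      using verts by (auto simp: graph_hom_def)
    then show "\<exists>f. graph_hom ?G H f" by blast
  next
    assume "\<exists>f. graph_hom ?G H f"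
    then obtain f where f: "graph_hom ?G H f" ..
    \<comment> \<open>\<open>f\<close> on \<open>G\<close> and the identification \<open>e\<close>
      on the copy of \<open>H\<close>; \<open>R\<close> is the graph of this map.\<close>
    define g where "g x = (if x < ?n then f x else e (x - ?n))" for x
    define R where "R = {(x, g x) | x. x < ?n + h}"
    have eH: "e i \<in> pverts H" if "i < h" for i
      using e that by (auto simp: bij_betw_def)
    have e_inv: "\<exists>i < h. u = e i" if "u \<in> pverts H" for u
      using e that by (auto simp: bij_betw_def)
    have g_e: "(?n + i, e i) \<in> R" if "i < h" for i
      using that by (auto simp: R_def g_def)
    have "g x \<in> pverts H" if "x < ?n + h" for x
      using f verts eH[of "x - ?n"] that by (auto simp: g_def graph_hom_def)
    then have R_sub: "R \<subseteq> pverts ?G' \<times> pverts H"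
      using verts by (auto simp: R_def)
    have "graph_relation ?G' H R"
    proof (rule graph_relationI)
      show "R \<subseteq> pverts ?G' \<times> pverts H" by (rule R_sub)
      show "pair_wf_digraph H" ..
      \<comment> \<open>The copy of \<open>H\<close> alone covers all vertices, and below all arcs,
        whatever \<open>f\<close> misses.\<close>
      show "\<exists>v. (v, u) \<in> R" if "u \<in> pverts H" for u
        using e_inv[OF that] g_e by blast
      show "(u, v) \<in> parcs H" if xy: "(x, y) \<in> parcs ?G'" "(x, u) \<in> R" "(y, v) \<in> R" for x y u v
      proof -
        have uv: "u = g x" "v = g y" using xy by (auto simp: R_def)
        consider "(x, y) \<in> parcs ?G" | i j where "x = ?n + i" "y = ?n + j" "(e i, e j) \<in> parcs H"
          using xy(1) arcs by auto
        then show ?thesis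
        proof cases
          case 1
          moreover from this have "x < ?n" "y < ?n" by (simp_all add: matrix_graph_def)
          ultimately show ?thesis using f uv by (auto simp: graph_hom_def g_def)
        qed (simp add: uv g_def)
      qed
      show "\<exists>(x, y) \<in> parcs ?G'. (x, u) \<in> R \<and> (y, v) \<in> R" if uv: "(u, v) \<in> parcs H" for u v
      proof -
        obtain i j where "i < h" "j < h" "u = e i" "v = e j"
          using e_inv[of u] e_inv[of v] H.arc_fst_in_verts[OF uv] H.arc_snd_in_verts[OF uv] by auto
        then show ?thesis
          using uv g_e arcs by (intro bexI[of _ "(?n + i, ?n + j)"]) auto
      qed
    qed
    moreover have "full_domain (pverts ?G') R"
      using verts by (auto simp: full_domain_def R_def)
    ultimately show "\<exists>R. graph_relation ?G' H R \<and> full_domain (pverts ?G') R" by blast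
  qed
  then show ?thesis by (simp only: b_def)
qed


section \<open>Full-domain relations as surjective homomorphisms\<close>

definition repeat_each :: "nat \<Rightarrow> 'a list \<Rightarrow> 'a list" where
  "repeat_each k xs = concat (map (replicate k) xs)"

lemma repeat_each_simps [simp]:
  "repeat_each k [] = []"
  "repeat_each k (x # xs) = replicate k x @ repeat_each k xs"
  by (simp_all add: repeat_each_def)

lemma length_repeat_each [simp]: "length (repeat_each k xs) = k * length xs"
  by (induction xs) auto

lemma set_repeat_each [simp]: "0 < k \<Longrightarrow> set (repeat_each k xs) = set xs"
  by (induction xs) auto

lemma nth_repeat_each: "i < k * length xs \<Longrightarrow> repeat_each k xs ! i = xs ! (i div k)"
proof (induction xs arbitrary: i)
  case (Cons x xs)
  show ?case
  proof (cases "i < k")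
    case True
    then show ?thesis by (simp add: nth_append)
  next
    case False
    have "0 < k"
      using Cons.prems by (cases k) auto
    \<comment> \<open>Skipping the first block lowers the quotient by one.\<close>
    then have "i - k < k * length xs" "i div k = Suc ((i - k) div k)"
      using False Cons.prems by (auto simp: le_div_geq)
    then show ?thesis
      using False Cons.IH[of "i - k"] by (simp add: nth_append)
  qed
qed simp

text \<open>In the blow-up, every vertex \<open>x\<close> is replaced by the \<open>k\<close> vertices \<open>k * x + i\<close> with \<open>i < k\<close>.\<close>

definition blow_up :: "nat \<Rightarrow> graph_letter list list \<Rightarrow> graph_letter list list" where
  "blow_up k rs = repeat_each k (map (repeat_each k) rs)"

lemma length_blow_up [simp]: "length (blow_up k rs) = k * length rs"
  by (simp add: blow_up_def)

lemma set_blow_up: "0 < k \<Longrightarrow> set (blow_up k rs) = repeat_each k ` set rs"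
  by (simp add: blow_up_def)

lemma separator_free_blow_up: "0 < k \<Longrightarrow> separator_free rs \<Longrightarrow> separator_free (blow_up k rs)"
  by (simp add: separator_free_def set_blow_up)

lemma div_less_of_less_mult: "i < k * n \<Longrightarrow> i div k < (n :: nat)"
  by (simp add: less_mult_imp_div_less mult.commute)

lemma blow_up_nth:
  assumes "\<And>r. r \<in> set rs \<Longrightarrow> length r = length rs" "i < k * length rs" "j < k * length rs"
  shows "blow_up k rs ! i ! j = rs ! (i div k) ! (j div k)"
  using assms div_less_of_less_mult[of i k "length rs"]
  by (simp add: blow_up_def nth_repeat_each)

lemma adjacency_blow_up:
  assumes "0 < k"
  shows "adjacency (blow_up k rs) \<longleftrightarrow> adjacency rs"
proof (cases "\<forall>r \<in> set rs. length r = length rs")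
  case True
  then have nth: "blow_up k rs ! i ! j = rs ! (i div k) ! (j div k)"
    if "i < k * length rs" "j < k * length rs" for i j
    using blow_up_nth that by blast
  have "\<forall>r \<in> set (blow_up k rs). length r = length (blow_up k rs)"
    using True assms by (simp add: set_blow_up)
  moreover have "(\<forall>i < k * length rs. \<forall>j < k * length rs.
        blow_up k rs ! i ! j = blow_up k rs ! j ! i) \<longleftrightarrow>
      (\<forall>i < length rs. \<forall>j < length rs. rs ! i ! j = rs ! j ! i)"
  proof (intro iffI allI impI)
    fix i j
    assume "\<forall>i < k * length rs. \<forall>j < k * length rs. blow_up k rs ! i ! j = blow_up k rs ! j ! i"
      and "i < length rs" "j < length rs"
    \<comment> \<open>\<open>k * i\<close> and \<open>k * j\<close> are the first copies of
      \<open>i\<close> and \<open>j\<close>, present because \<open>0 < k\<close>.\<close>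
    then show "rs ! i ! j = rs ! j ! i"
      using nth[of "k * i" "k * j"] nth[of "k * j" "k * i"] assms by simp
  next
    fix i j
    assume "\<forall>i < length rs. \<forall>j < length rs. rs ! i ! j = rs ! j ! i"
      and "i < k * length rs" "j < k * length rs"
    then show "blow_up k rs ! i ! j = blow_up k rs ! j ! i"
      by (simp add: nth div_less_of_less_mult)
  qed
  ultimately show ?thesis
    using True by (simp add: adjacency_def)
next
  case False
  \<comment> \<open>Row lengths and the number of rows are all multiplied by \<open>k > 0\<close>,
    so a mismatch survives.\<close>
  then have "\<not> adjacency (blow_up k rs)"
    using assms by (auto simp: adjacency_def set_blow_up)
  moreover have "\<not> adjacency rs"
    using False by (auto simp: adjacency_def)
  ultimately show ?thesis by blast
qed

section \<open>Surjective homomorphisms from the blow-up\<close>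

text \<open>Surplus indices repeat one fixed element, which is why \<open>A\<close> must be
  nonempty.\<close>

lemma ex_enumeration_below:
  assumes "finite A" "A \<noteq> {}" "card A \<le> k"
  shows "\<exists>g. g ` {..<k :: nat} = A"
proof -
  obtain g where g: "bij_betw g {0..<card A} A"
    using ex_bij_betw_nat_finite[OF assms(1)] by blast
  obtain a where "a \<in> A" using assms(2) by blast
  have "(\<lambda>i. if i < card A then g i else a) ` {..<k} = A"
  proof (intro equalityI subsetI)
    fix x assume "x \<in> A"
    then have "x \<in> g ` {0..<card A}"
      using g by (simp add: bij_betw_def)
    then obtain i where "i < card A" "x = g i"
      by auto
    then show "x \<in> (\<lambda>i. if i < card A then g i else a) ` {..<k}"
      using assms(3) by force
  qed (use g \<open>a \<in> A\<close> in \<open>auto simp: bij_betw_def\<close>)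
  then show ?thesis by blast
qed

text \<open>An arc becomes all arcs between copies of its ends, also for loops. This matches
  \<open>graph_star\<close>, which joins every pair of vertices related to the ends of an
  arc.\<close>

lemma surjective_hom_blow_up_iff:
  assumes H: "pair_pseudo_graph H" and k: "card (pverts H) \<le> k" "0 < k"
    and len: "\<And>r. r \<in> set rs \<Longrightarrow> length r = length rs"
  shows "(\<exists>f. surjective_hom (matrix_graph (blow_up k rs)) H f) \<longleftrightarrow>
    (\<exists>R. graph_relation (matrix_graph rs) H R \<and> full_domain (pverts (matrix_graph rs)) R)"
proof -
  interpret H: pair_pseudo_graph H by fact
  let ?n = "length rs"
  let ?G = "matrix_graph rs" and ?G' = "matrix_graph (blow_up k rs)"
  have verts: "pverts ?G' = {..<k * ?n}" "pverts ?G = {..<?n}"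
    by (simp_all add: matrix_graph_def)
  have arcs: "(i, j) \<in> parcs ?G' \<longleftrightarrow>
      i < k * ?n \<and> j < k * ?n \<and> (i div k, j div k) \<in> parcs ?G" for i j
    using blow_up_nth[OF len, where i = i and j = j and k = k]
    by (auto simp: matrix_graph_def div_less_of_less_mult)
  have copy_less: "k * x + i < k * ?n" if "x < ?n" "i < k" for x i
  proof -
    have "k * x + i < k * Suc x" using that by simp
    also have "\<dots> \<le> k * ?n" using that by (intro mult_le_mono2) simp
    finally show ?thesis .
  qed
  show ?thesis
  proof
    assume "\<exists>f. surjective_hom ?G' H f"
    then obtain f where f: "surjective_hom ?G' H f" ..
    \<comment> \<open>Relates \<open>x\<close> to the images of all its copies.\<close>
    define R where "R = {(i div k, f i) | i. i < k * ?n}"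
    have "graph_relation ?G H R"
    proof (rule graph_relationI)
      show "R \<subseteq> pverts ?G \<times> pverts H"
        using f verts
        by (auto simp: R_def surjective_hom_def graph_hom_def div_less_of_less_mult)
      show "pair_wf_digraph H" ..
      show "\<exists>x. (x, u) \<in> R" if u: "u \<in> pverts H" for u
      proof -
        have "u \<in> f ` {..<k * ?n}"
          using f verts u by (simp add: surjective_hom_def)
        then show ?thesis by (auto simp: R_def)
      qed
      show "(u, v) \<in> parcs H" if xy: "(x, y) \<in> parcs ?G" "(x, u) \<in> R" "(y, v) \<in> R" for x y u v
      proof -
        obtain i j where "i < k * ?n" "j < k * ?n" "x = i div k" "y = j div k" "u = f i" "v = f j"
          using xy(2,3) by (auto simp: R_def)
        then have "(i, j) \<in> parcs ?G'" "u = f i" "v = f j"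
          using xy(1) arcs by auto
        then show ?thesis
          using f by (auto simp: surjective_hom_def graph_hom_def)
      qed
      show "\<exists>(x, y) \<in> parcs ?G. (x, u) \<in> R \<and> (y, v) \<in> R" if uv: "(u, v) \<in> parcs H" for u v
      proof -
        have "(u, v) \<in> (\<lambda>(x, y). (f x, f y)) ` parcs ?G'"
          using uv f by (simp add: surjective_hom_def)
        then obtain i j where "(i, j) \<in> parcs ?G'" "u = f i" "v = f j"
          by auto
        then show ?thesis
          using arcs[of i j] by (intro bexI[of _ "(i div k, j div k)"]) (auto simp: R_def)
      qed
    qed
    moreover have "full_domain (pverts ?G) R"
      unfolding full_domain_def
    proof
      fix x assume "x \<in> pverts ?G"
      then have "(x, f (k * x)) \<in> R"
        using verts copy_less[of x 0] k(2) by (auto simp: R_def intro!: exI[of _ "k * x"])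
      then show "\<exists>u. (x, u) \<in> R" ..
    qed
    ultimately show "\<exists>R. graph_relation ?G H R \<and> full_domain (pverts ?G) R" by blast
  next
    assume "\<exists>R. graph_relation ?G H R \<and> full_domain (pverts ?G) R"
    then obtain R where R: "graph_relation ?G H R" "full_domain (pverts ?G) R" by blast
    have R_sub: "R \<subseteq> {..<?n} \<times> pverts H"
      using R(1) verts by (simp add: graph_relation_def)
    have "\<exists>g. g ` {..<k} = R `` {x}" if "x < ?n" for x
    proof (rule ex_enumeration_below)
      show "finite (R `` {x})"
        using R_sub H.pair_finite_verts by (auto intro: finite_subset)
      show "R `` {x} \<noteq> {}"
        using R(2) that verts by (auto simp: full_domain_def)
      have "card (R `` {x}) \<le> card (pverts H)"
        using R_sub H.pair_finite_verts by (intro card_mono) auto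
      then show "card (R `` {x}) \<le> k" using k(1) by simp
    qed
    then obtain g where g: "\<And>x. x < ?n \<Longrightarrow> g x ` {..<k} = R `` {x}" by metis
    \<comment> \<open>Quotient and remainder are the original vertex and the number of the
      copy.\<close>
    define f where "f i = g (i div k) (i mod k)" for i
    have f_copy: "f (k * x + i) = g x i" if "i < k" for x i
      using that by (simp add: f_def)
    have f_in: "(i div k, f i) \<in> R" if "i < k * ?n" for i
      using g[of "i div k"] div_less_of_less_mult[OF that] k(2)
      by (auto simp: f_def)
    \<comment> \<open>Every pair of \<open>R\<close> is realised by some copy; surjectivity on
      vertices and on arcs both rest on this.\<close>
    have lift: "\<exists>i < k * ?n. i div k = x \<and> f i = u" if xu: "(x, u) \<in> R" for x u
    proof -
      have x: "x < ?n" using R_sub xu by auto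
      then obtain i where "i < k" "u = g x i" using g[OF x] xu by auto
      then show ?thesis
        using x copy_less f_copy by (intro exI[of _ "k * x + i"]) auto
    qed
    have "f i \<in> pverts H" if "i < k * ?n" for i
      using f_in[OF that] R_sub by auto
    moreover have "(f i, f j) \<in> parcs H" if "(i, j) \<in> parcs ?G'" for i j
    proof (rule graph_relation_arcD[OF R(1)])
      have ij: "i < k * ?n" "j < k * ?n" "(i div k, j div k) \<in> parcs ?G"
        using that arcs[of i j] by simp_all
      show "(i div k, j div k) \<in> parcs ?G" by (rule ij(3))
      show "(i div k, f i) \<in> R" "(j div k, f j) \<in> R" using ij f_in by simp_all
    qed
    ultimately have hom: "graph_hom ?G' H f"
      using verts by (auto simp: graph_hom_def)
    have "f ` pverts ?G' = pverts H"
    proof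
      show "f ` pverts ?G' \<subseteq> pverts H" using hom by (auto simp: graph_hom_def)
      show "pverts H \<subseteq> f ` pverts ?G'"
      proof
        fix u assume "u \<in> pverts H"
        then obtain x where "(x, u) \<in> R"
          using R(1) by (auto simp: graph_relation_def full_image_def)
        then obtain i where "i < k * ?n" "f i = u" using lift by blast
        then show "u \<in> f ` pverts ?G'" using verts by auto
      qed
    qed
    moreover have "(\<lambda>(x, y). (f x, f y)) ` parcs ?G' = parcs H"
    proof
      show "(\<lambda>(x, y). (f x, f y)) ` parcs ?G' \<subseteq> parcs H" using hom by (auto simp: graph_hom_def)
      show "parcs H \<subseteq> (\<lambda>(x, y). (f x, f y)) ` parcs ?G'"
      proof clarify
        fix u v assume "(u, v) \<in> parcs H"
        then have "(u, v) \<in> parcs (graph_star ?G (pverts H) R)"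
          using R(1) by (simp add: graph_relation_def)
        then obtain x y where xy: "(x, y) \<in> parcs ?G" "(x, u) \<in> R" "(y, v) \<in> R"
          by (auto simp: graph_star_def)
        \<comment> \<open>The two copies are chosen independently, also when \<open>x = y\<close>;
          any two copies of the ends of an arc are joined.\<close>
        obtain i j where "i < k * ?n" "i div k = x" "f i = u" "j < k * ?n" "j div k = y" "f j = v"
          using lift[OF xy(2)] lift[OF xy(3)] by blast
        then show "(u, v) \<in> (\<lambda>(x, y). (f x, f y)) ` parcs ?G'"
          using xy(1) arcs[of i j] by (intro image_eqI[of _ _ "(i, j)"]) auto
      qed
    qed
    ultimately show "\<exists>f. surjective_hom ?G' H f"
      using hom by (auto simp: surjective_hom_def)
  qed
qed


section \<open>The reduction of homomorphisms to relations\<close>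

text \<open>
  Every number needed for the new rows is obtained by rescanning the input: row \<open>j\<close> of the second
  graph is preceded by one zero for each separator of the input.
\<close>

datatype union_state = Pad | Check | Rewind nat | Count nat

text \<open>\<open>Check\<close> stays in place so that \<open>Rewind 0\<close> starts at the same
  position as every later \<open>Rewind\<close>, and the rounds compose.\<close>

fun union_tr :: "nat \<Rightarrow> (nat \<Rightarrow> graph_letter list) \<Rightarrow> union_state \<Rightarrow> graph_letter option \<Rightarrow>
    (union_state, graph_letter) outcome" where
  "union_tr h row Pad (Some a) =
     Move Pad Right (if a = Sep then replicate h Zero @ [Sep] else [a])"
| "union_tr h row Pad None = Move Check Left []"
| "union_tr h row Check s =
     (if s = None \<or> s = Some Sep then Move (Rewind 0) Stay [] else Reject)"
| "union_tr h row (Rewind j) (Some a) = Move (Rewind j) Left []"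
| "union_tr h row (Rewind j) None = (if j = h then Query else Move (Count j) Right [])"
| "union_tr h row (Count j) (Some a) = Move (Count j) Right (if a = Sep then [Zero] else [])"
| "union_tr h row (Count j) None = Move (Rewind (Suc j)) Left (row j @ [Sep])"

text \<open>Padding and new rows are the longest outputs: \<open>h\<close> letters and a separator.
  \<open>Count h\<close> does not occur because \<open>Rewind h\<close> ends in the query.\<close>

lemma transducer_union_tr:
  assumes "\<And>j. j < h \<Longrightarrow> length (row j) = h"
  shows "transducer (union_tr h row) ({Pad, Check} \<union> Rewind ` {..h} \<union> Count ` {..<h}) Pad (Suc h)"
proof
  fix q s q' d u
  assume "q \<in> {Pad, Check} \<union> Rewind ` {..h} \<union> Count ` {..<h}"
    and "union_tr h row q s = Move q' d u"
  then show "q' \<in> {Pad, Check} \<union> Rewind ` {..h} \<union> Count ` {..<h} \<and> length u \<le> Suc h"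
    using assms by (cases q; cases s) (auto split: if_splits)
qed auto

text \<open>Two sweeps and two turns make one round.\<close>

lemma runs_union_row:
  assumes "j < h"
  shows "runs (union_tr h row) w (2 * length w + 2) (Rewind j, int (length w) - 1, v)
    (Rewind (Suc j), int (length w) - 1,
     v @ concat (map (\<lambda>a. if a = Sep then [Zero] else []) w) @ row j @ [Sep])"
proof -
  let ?tr = "union_tr h row" and ?z = "concat (map (\<lambda>a. if a = Sep then [Zero] else []) w)"
  have "runs ?tr w (length w) (Rewind j, int (length w) - 1, v) (Rewind j, -1, v)"
    using runs_scan_left[of w ?tr "Rewind j" "[]" "[]" v] by simp
  moreover have "runs ?tr w 1 (Rewind j, -1, v) (Count j, 0, v)"
    using runs_single[of ?tr "Rewind j" w "-1" "Count j" Right "[]" v] assms by simp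
  moreover have "runs ?tr w (length w) (Count j, 0, v) (Count j, int (length w), v @ ?z)"
    using runs_scan_right[of w ?tr "Count j" "\<lambda>a. if a = Sep then [Zero] else []" "[]" "[]" v]
    by simp
  moreover have "runs ?tr w 1 (Count j, int (length w), v @ ?z)
      (Rewind (Suc j), int (length w) - 1, v @ ?z @ row j @ [Sep])"
    using runs_single[of ?tr "Count j" w "int (length w)" "Rewind (Suc j)" Left "row j @ [Sep]"
        "v @ ?z"] by simp
  ultimately have "runs ?tr w (length w + (1 + (length w + 1)))
      (Rewind j, int (length w) - 1, v)
      (Rewind (Suc j), int (length w) - 1, v @ ?z @ row j @ [Sep])"
    by (meson runs_trans)
  then show ?thesis by (simp add: mult_2)
qed

lemma runs_union_rows:
  "j \<le> h \<Longrightarrow> runs (union_tr h row) w (j * (2 * length w + 2)) (Rewind 0, int (length w) - 1, v)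
    (Rewind j, int (length w) - 1, v @ concat (map (\<lambda>j.
       concat (map (\<lambda>a. if a = Sep then [Zero] else []) w) @ row j @ [Sep]) [0..<j]))"
proof (induction j)
  case 0
  then show ?case by (simp add: runs.refl)
next
  case (Suc j)
  from runs_trans[OF Suc.IH runs_union_row] Suc.prems show ?case
    by (simp add: add_ac)
qed

lemma count_separators:
  "separator_free rs \<Longrightarrow> concat (map (\<lambda>a. if a = Sep then [Zero] else []) (encode_rows rs))
    = replicate (length rs) Zero"
proof (induction rs)
  case (Cons r rs)
  have "concat (map (\<lambda>a. if a = Sep then [Zero] else []) r) = []"
    using Cons.prems by auto
  then show ?case using Cons by simp
qed simp

lemma pad_rows:
  "separator_free rs \<Longrightarrow>
    concat (map (\<lambda>a. if a = Sep then replicate h Zero @ [Sep] else [a]) (encode_rows rs))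
    = encode_rows (map (\<lambda>r. r @ replicate h Zero) rs)"
proof (induction rs)
  case (Cons r rs)
  have "concat (map (\<lambda>a. if a = Sep then replicate h Zero @ [Sep] else [a]) r) = r"
    if "Sep \<notin> set r" for r using that by (induction r) auto
  then show ?case using Cons by simp
qed simp

lemma runs_union:
  assumes row: "row = (\<lambda>j. map (\<lambda>i. if b j i then One else Zero) [0..<h])"
    and rs: "separator_free rs" and t: "Sep \<notin> set t" and w: "w = encode_rows rs @ t"
  shows "\<exists>n \<le> (2 * h + 2) * Suc (length w). \<exists>q p v. runs (union_tr h row) w n (Pad, 0, []) (q, p, v) \<and>
    (if t = [] then union_tr h row q (cell w p) = Query \<and> v = encode_rows (add_graph h b rs)
     else union_tr h row q (cell w p) = Reject)"
proof -
  let ?tr = "union_tr h row"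
  let ?v = "concat (map (\<lambda>a. if a = Sep then replicate h Zero @ [Sep] else [a]) w)"
  have "runs ?tr w (length w) (Pad, 0, []) (Pad, int (length w), ?v)"
    using runs_scan_right[of w ?tr Pad "\<lambda>a. if a = Sep then replicate h Zero @ [Sep] else [a]"
        "[]" "[]" "[]"] by simp
  moreover have "runs ?tr w 1 (Pad, int (length w), ?v) (Check, int (length w) - 1, ?v)"
    using runs_single[of ?tr Pad w "int (length w)" Check Left "[]" ?v] by simp
  ultimately have 1: "runs ?tr w (length w + 1) (Pad, 0, []) (Check, int (length w) - 1, ?v)"
    by (rule runs_trans)
  show ?thesis
  proof (cases "t = []")
    case False
    then have "cell w (int (length w) - 1) \<notin> {None, Some Sep}"
      using last_cell_separator_iff[OF t w] by simp
    then have "?tr Check (cell w (int (length w) - 1)) = Reject" by simp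
    moreover have "length w + 1 \<le> (2 * h + 2) * Suc (length w)" by simp
    ultimately show ?thesis
      using 1 False by (intro exI[of _ "length w + 1"] conjI exI[of _ Check]
        exI[of _ "int (length w) - 1"] exI[of _ ?v]) simp_all
  next
    case True
    then have "cell w (int (length w) - 1) \<in> {None, Some Sep}"
      using last_cell_separator_iff[OF t w] by simp
    then have 2: "runs ?tr w 1 (Check, int (length w) - 1, ?v) (Rewind 0, int (length w) - 1, ?v)"
      using runs_single[of ?tr Check w "int (length w) - 1" "Rewind 0" Stay "[]" ?v] by simp
    let ?u = "?v @ concat (map (\<lambda>j.
       concat (map (\<lambda>a. if a = Sep then [Zero] else []) w) @ row j @ [Sep]) [0..<h])"
    have 3: "runs ?tr w (h * (2 * length w + 2)) (Rewind 0, int (length w) - 1, ?v)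
        (Rewind h, int (length w) - 1, ?u)"
      using runs_union_rows[of h h row w ?v] by simp
    \<comment> \<open>The query is made at position -1, where \<open>Rewind h\<close> reads
      \<open>None\<close>.\<close>
    have 4: "runs ?tr w (length w) (Rewind h, int (length w) - 1, ?u) (Rewind h, -1, ?u)"
      using runs_scan_left[of w ?tr "Rewind h" "[]" "[]" ?u] by simp
    have "?u = encode_rows (map (\<lambda>r. r @ replicate h Zero) rs) @
        encode_rows (map (\<lambda>j. replicate (length rs) Zero @ row j) [0..<h])"
      using True w rs
      by (simp add: pad_rows count_separators encode_rows_def[of "map _ [0..<h]"] comp_def)
    then have "?u = encode_rows (add_graph h b rs)"
      by (simp add: add_graph_def row)
    \<comment> \<open>Padding, check, \<open>h\<close> rounds and the last rewind; the sum equals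
      the bound.\<close>
    moreover have "length w + 1 + (1 + (h * (2 * length w + 2) + length w))
        \<le> (2 * h + 2) * Suc (length w)"
      by (simp add: algebra_simps)
    ultimately show ?thesis
      using runs_trans[OF 1 runs_trans[OF 2 runs_trans[OF 3 4]]] True
      by (intro exI conjI) (assumption, assumption, simp)
  qed
qed

theorem Hom_reducible_FulRel:
  assumes "pair_pseudo_graph H"
  shows "Hom H \<le>\<^sub>P\<^sup>T\<^sup>u\<^sup>r FulRel H"
proof -
  interpret H: pair_pseudo_graph H by fact
  define h where "h = card (pverts H)"
  obtain e where e: "bij_betw e {..<h} (pverts H)"
    using ex_bij_betw_nat_finite[OF H.pair_finite_verts] by (auto simp: h_def atLeast0LessThan)
  define b where "b = (\<lambda>i j. (e i, e j) \<in> parcs H)"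
  have b_sym: "b i j \<longleftrightarrow> b j i" for i j
    by (auto simp: b_def dest: H.arcs_symmetric)
  define row where "row = (\<lambda>j. map (\<lambda>i. if b j i then One else Zero) [0..<h])"
  interpret transducer "union_tr h row" "{Pad, Check} \<union> Rewind ` {..h} \<union> Count ` {..<h}" Pad "Suc h"
    by (rule transducer_union_tr) (simp add: row_def)
  have iff: "encode_rows rs \<in> Hom H \<longleftrightarrow> encode_rows (add_graph h b rs) \<in> FulRel H"
    if rs: "separator_free rs" for rs
  proof -
    have "adjacency rs \<Longrightarrow>
      (\<exists>R. graph_relation (matrix_graph (add_graph h b rs)) H R \<and>
        full_domain (pverts (matrix_graph (add_graph h b rs))) R) \<longleftrightarrow>
      (\<exists>f. graph_hom (matrix_graph rs) H f)"
      unfolding b_def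
      by (rule full_relation_add_graph_iff[OF assms e]) (simp add: adjacency_def)
    \<comment> \<open>If \<open>rs\<close> is invalid, so is its image, and both memberships
      fail.\<close>
    then show ?thesis
      using rs adjacency_add_graph[of h b rs] b_sym
      by (auto simp: Hom_def FulRel_def encode_rows_in_decision_problem separator_free_add_graph)
  qed
  show ?thesis
  proof (rule reducible[of "2 * h + 2"])
    fix w
    obtain rs t where w: "separator_free rs" "Sep \<notin> set t" "w = encode_rows rs @ t"
      using word_split by blast
    have "t \<noteq> [] \<Longrightarrow> w \<notin> Hom H"
      using w trailing_letters_not_in_decision_problem by (auto simp: Hom_def)
    moreover have "t = [] \<Longrightarrow> w \<in> Hom H \<longleftrightarrow> encode_rows (add_graph h b rs) \<in> FulRel H"
      using w iff by simp
    ultimately show "\<exists>n \<le> (2 * h + 2) * Suc (length w). \<exists>q p v.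
        runs (union_tr h row) w n (Pad, 0, []) (q, p, v) \<and>
        (union_tr h row q (cell w p) = Reject \<and> w \<notin> Hom H \<or>
         union_tr h row q (cell w p) = Query \<and> (w \<in> Hom H \<longleftrightarrow> v \<in> FulRel H))"
      using runs_union[OF row_def w] by (cases "t = []") (simp_all, blast+)
  qed
qed


section \<open>The reduction of relations to surjective homomorphisms\<close>

text \<open>The index counts the copies of the current row that are already complete.\<close>

datatype blow_up_state = Copy nat | Return nat | Inspect

fun blow_up_tr :: "nat \<Rightarrow> blow_up_state \<Rightarrow> graph_letter option \<Rightarrow>
    (blow_up_state, graph_letter) outcome" where
  "blow_up_tr k (Copy c) (Some a) =
     (if a \<noteq> Sep then Move (Copy c) Right (replicate k a)
      else if Suc c < k then Move (Return (Suc c)) Left [Sep]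
      else Move (Copy 0) Right [Sep])"
| "blow_up_tr k (Copy c) None = Move Inspect Left []"
| "blow_up_tr k (Return c) s =
     (if s = None \<or> s = Some Sep then Move (Copy c) Right [] else Move (Return c) Left [])"
| "blow_up_tr k Inspect s = (if s = None \<or> s = Some Sep then Query else Reject)"

text \<open>Outputs are empty, \<open>k\<close> equal letters or one separator, which fits since
  \<open>0 < k\<close>.\<close>

lemma transducer_blow_up_tr:
  assumes "0 < k"
  shows "transducer (blow_up_tr k) (Copy ` {..<k} \<union> Return ` {..<k} \<union> {Inspect}) (Copy 0) k"
proof
  fix q s q' d u
  assume "q \<in> Copy ` {..<k} \<union> Return ` {..<k} \<union> {Inspect}"
    and "blow_up_tr k q s = Move q' d u"
  then show "q' \<in> Copy ` {..<k} \<union> Return ` {..<k} \<union> {Inspect} \<and> length u \<le> k"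
    using assms by (cases q; cases s) (auto split: if_splits)
qed (use assms in auto)

lemma runs_copy:
  assumes "Sep \<notin> set r"
  shows "runs (blow_up_tr k) (u @ r @ x) (length r) (Copy c, int (length u), v)
    (Copy c, int (length (u @ r)), v @ repeat_each k r)"
  unfolding repeat_each_def using assms by (intro runs_scan_right) auto

text \<open>Induction on the number \<open>k - c\<close> of copies still to be written. The
  condition on \<open>u\<close> makes \<open>Return\<close> stop exactly before the row.\<close>

lemma runs_blow_up_row:
  assumes r: "Sep \<notin> set r" and u: "u = [] \<or> last u = Sep" and c: "c < k"
  shows "\<exists>n \<le> (k - c) * (2 * length r + 2). runs (blow_up_tr k) (u @ r @ Sep # x) n
    (Copy c, int (length u), v)
    (Copy 0, int (length (u @ r @ [Sep])), v @ encode_rows (replicate (k - c) (repeat_each k r)))"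
  using c
proof (induction "k - c" arbitrary: c v)
  case (Suc m)
  let ?tr = "blow_up_tr k" and ?w = "u @ r @ Sep # x" and ?y = "repeat_each k r @ [Sep]"
  have 1: "runs ?tr ?w (length r) (Copy c, int (length u), v)
      (Copy c, int (length (u @ r)), v @ repeat_each k r)"
    using r by (rule runs_copy)
  have sep: "cell ?w (int (length (u @ r))) = Some Sep"
    using cell_append[of "u @ r" Sep x] by simp
  show ?case
  proof (cases "Suc c < k")
    case False
    then have "k - c = 1" using Suc by simp
    \<comment> \<open>The last copy needs no return: the head passes the separator and the counter
      is reset.\<close>
    have "runs ?tr ?w 1 (Copy c, int (length (u @ r)), v @ repeat_each k r)
        (Copy 0, int (length (u @ r @ [Sep])), v @ ?y)"
      using runs_single[of ?tr "Copy c" ?w "int (length (u @ r))" "Copy 0" Right "[Sep]"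
          "v @ repeat_each k r"] sep False by (simp add: add_ac)
    from runs_trans[OF 1 this] show ?thesis
      using \<open>k - c = 1\<close> by (intro exI[of _ "length r + 1"]) simp
  next
    case True
    have 2: "runs ?tr ?w 1 (Copy c, int (length (u @ r)), v @ repeat_each k r)
        (Return (Suc c), int (length (u @ r)) - 1, v @ ?y)"
      using runs_single[of ?tr "Copy c" ?w "int (length (u @ r))" "Return (Suc c)" Left "[Sep]"
          "v @ repeat_each k r"] sep True by simp
    have 3: "runs ?tr ?w (length r) (Return (Suc c), int (length (u @ r)) - 1, v @ ?y)
        (Return (Suc c), int (length u) - 1, v @ ?y)"
      using r by (intro runs_scan_left) auto
    have "cell ?w (int (length u) - 1) \<in> {None, Some Sep}"
      using u by (cases u rule: rev_cases) (auto simp: cell_def nth_append nat_diff_distrib)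
    then have 4: "runs ?tr ?w 1 (Return (Suc c), int (length u) - 1, v @ ?y)
        (Copy (Suc c), int (length u), v @ ?y)"
      using runs_single[of ?tr "Return (Suc c)" ?w "int (length u) - 1" "Copy (Suc c)" Right "[]"
          "v @ ?y"] by simp
    have "m = k - Suc c" using Suc by simp
    then obtain n where n: "n \<le> (k - Suc c) * (2 * length r + 2)"
      and 5: "runs ?tr ?w n (Copy (Suc c), int (length u), v @ ?y) (Copy 0,
        int (length (u @ r @ [Sep])), (v @ ?y) @ encode_rows (replicate (k - Suc c) (repeat_each k r)))"
      using Suc.hyps(1)[of "Suc c" "v @ ?y"] True by blast
    have kc: "k - c = Suc (k - Suc c)" using True by simp
    \<comment> \<open>One sweep, a turn, the way back and another turn per copy.\<close>
    have "length r + (1 + (length r + (1 + n))) \<le> (k - c) * (2 * length r + 2)"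
      unfolding kc using n by simp
    moreover have "(v @ ?y) @ encode_rows (replicate (k - Suc c) (repeat_each k r))
        = v @ encode_rows (replicate (k - c) (repeat_each k r))"
      by (simp add: kc)
    then have "runs ?tr ?w (length r + (1 + (length r + (1 + n)))) (Copy c, int (length u), v)
        (Copy 0, int (length (u @ r @ [Sep])),
         v @ encode_rows (replicate (k - c) (repeat_each k r)))"
      using runs_trans[OF 1 runs_trans[OF 2 runs_trans[OF 3 runs_trans[OF 4 5]]]] by (simp only:)
    ultimately show ?thesis by blast
  qed
qed simp

text \<open>A row costs at most \<open>2 * k\<close> steps per letter, its separator included. After
  each row the prefix ends in \<open>Sep\<close>, as the next row requires.\<close>

lemma runs_blow_up_rows:
  assumes "separator_free rs" "u = [] \<or> last u = Sep" "0 < k"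
  shows "\<exists>n \<le> 2 * k * length (encode_rows rs). runs (blow_up_tr k) (u @ encode_rows rs @ x) n
    (Copy 0, int (length u), v)
    (Copy 0, int (length (u @ encode_rows rs)), v @ encode_rows (blow_up k rs))"
  using assms
proof (induction rs arbitrary: u v)
  case Nil
  then show ?case by (simp add: runs.refl blow_up_def)
next
  case (Cons r rs)
  let ?u = "u @ r @ [Sep]" and ?y = "encode_rows (replicate k (repeat_each k r))"
  obtain m where m: "m \<le> k * (2 * length r + 2)"
    "runs (blow_up_tr k) (u @ r @ Sep # encode_rows rs @ x) m (Copy 0, int (length u), v)
      (Copy 0, int (length ?u), v @ ?y)"
    using runs_blow_up_row[of r u 0 k "encode_rows rs @ x" v] Cons.prems by auto
  obtain n where n: "n \<le> 2 * k * length (encode_rows rs)"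
    "runs (blow_up_tr k) (?u @ encode_rows rs @ x) n (Copy 0, int (length ?u), v @ ?y)
      (Copy 0, int (length (?u @ encode_rows rs)), (v @ ?y) @ encode_rows (blow_up k rs))"
    using Cons.IH[of ?u "v @ ?y"] Cons.prems by auto
  have "runs (blow_up_tr k) (u @ encode_rows (r # rs) @ x) (m + n) (Copy 0, int (length u), v)
    (Copy 0, int (length (u @ encode_rows (r # rs))), v @ encode_rows (blow_up k (r # rs)))"
    using runs_trans[OF m(2)] n(2) by (simp add: blow_up_def)
  moreover have "m + n \<le> 2 * k * length (encode_rows (r # rs))"
    using m(1) n(1) by (simp add: algebra_simps)
  ultimately show ?case by blast
qed

lemma runs_blow_up:
  assumes rs: "separator_free rs" and t: "Sep \<notin> set t" and w: "w = encode_rows rs @ t"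
    and k: "0 < k"
  shows "\<exists>n \<le> (2 * k + 1) * Suc (length w). \<exists>q p v. runs (blow_up_tr k) w n (Copy 0, 0, []) (q, p, v) \<and>
    (if t = [] then blow_up_tr k q (cell w p) = Query \<and> v = encode_rows (blow_up k rs)
     else blow_up_tr k q (cell w p) = Reject)"
proof -
  let ?tr = "blow_up_tr k" and ?v = "encode_rows (blow_up k rs)"
  obtain n where n: "n \<le> 2 * k * length (encode_rows rs)"
    and 1: "runs ?tr w n (Copy 0, 0, []) (Copy 0, int (length (encode_rows rs)), ?v)"
    using runs_blow_up_rows[OF rs, of "[]" k t "[]"] k w by auto
  have 2: "runs ?tr w (length t) (Copy 0, int (length (encode_rows rs)), ?v)
      (Copy 0, int (length w), ?v @ repeat_each k t)"
    using runs_copy[OF t, of k "encode_rows rs" "[]" 0 ?v] w by simp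
  have 3: "runs ?tr w 1 (Copy 0, int (length w), ?v @ repeat_each k t)
      (Inspect, int (length w) - 1, ?v @ repeat_each k t)"
    using runs_single[of ?tr "Copy 0" w "int (length w)" Inspect Left "[]"] by simp
  have "if t = [] then ?tr Inspect (cell w (int (length w) - 1)) = Query \<and>
        ?v @ repeat_each k t = encode_rows (blow_up k rs)
      else ?tr Inspect (cell w (int (length w) - 1)) = Reject"
    using last_cell_separator_iff[OF t w] by simp
  moreover have "n + (length t + 1) \<le> (2 * k + 1) * Suc (length w)"
    using n w by (simp add: algebra_simps)
  ultimately show ?thesis
    using runs_trans[OF 1 runs_trans[OF 2 3]]
    by (intro exI conjI) assumption+
qed

theorem FulRel_reducible_SurHom:
  assumes "pair_pseudo_graph H"
  shows "FulRel H \<le>\<^sub>P\<^sup>T\<^sup>u\<^sup>r SurHom H"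
proof -
  \<comment> \<open>\<open>k\<close> must be positive even if \<open>H\<close> is the null graph, lest the blow-up lose all vertices of \<open>G\<close>.\<close>
  define k where "k = Suc (card (pverts H))"
  have k: "card (pverts H) \<le> k" "0 < k" by (simp_all add: k_def)
  interpret transducer "blow_up_tr k" "Copy ` {..<k} \<union> Return ` {..<k} \<union> {Inspect}" "Copy 0" k
    using k(2) by (rule transducer_blow_up_tr)
  have iff: "encode_rows rs \<in> FulRel H \<longleftrightarrow> encode_rows (blow_up k rs) \<in> SurHom H"
    if rs: "separator_free rs" for rs
  proof -
    have "adjacency rs \<Longrightarrow> (\<exists>f. surjective_hom (matrix_graph (blow_up k rs)) H f) \<longleftrightarrow>
      (\<exists>R. graph_relation (matrix_graph rs) H R \<and> full_domain (pverts (matrix_graph rs)) R)"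
      by (rule surjective_hom_blow_up_iff[OF assms k]) (simp add: adjacency_def)
    \<comment> \<open>For invalid \<open>rs\<close> both sides are false by
      \<open>adjacency_blow_up\<close>.\<close>
    then show ?thesis
      using rs k adjacency_blow_up[of k rs]
      by (auto simp: SurHom_def FulRel_def encode_rows_in_decision_problem separator_free_blow_up)
  qed
  show ?thesis
  proof (rule reducible[of "2 * k + 1"])
    fix w
    obtain rs t where w: "separator_free rs" "Sep \<notin> set t" "w = encode_rows rs @ t"
      using word_split by blast
    have "t \<noteq> [] \<Longrightarrow> w \<notin> FulRel H"
      using w trailing_letters_not_in_decision_problem by (auto simp: FulRel_def)
    moreover have "t = [] \<Longrightarrow> w \<in> FulRel H \<longleftrightarrow> encode_rows (blow_up k rs) \<in> SurHom H"
      using w iff by simp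
    ultimately show "\<exists>n \<le> (2 * k + 1) * Suc (length w). \<exists>q p v.
        runs (blow_up_tr k) w n (Copy 0, 0, []) (q, p, v) \<and>
        (blow_up_tr k q (cell w p) = Reject \<and> w \<notin> FulRel H \<or>
         blow_up_tr k q (cell w p) = Query \<and> (w \<in> FulRel H \<longleftrightarrow> v \<in> SurHom H))"
      using runs_blow_up[OF w k(2)] by (cases "t = []") (simp_all, blast+)
  qed
qed

theorem theorem6p1:
  fixes H :: "'b pair_pre_digraph"
  assumes "pair_pseudo_graph H"
  shows "Hom H \<le>\<^sub>P\<^sup>T\<^sup>u\<^sup>r FulRel H \<and> FulRel H \<le>\<^sub>P\<^sup>T\<^sup>u\<^sup>r SurHom H"
  using assms Hom_reducible_FulRel FulRel_reducible_SurHom by blast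

end
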